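(* Let $R$ be a commutative unitary integral domain of characteristic $0$ and let $a\in R$. Then there exists at least one non-identical partial order $\preceq$ on $R$ making $R$ an ordered domain with $0\prec a$ if and only if the polynomial $\min_{\mathbb{Q}}(a)$ has a real positive root.
   Context: A commutative unitary domain $R$ with a partial order $\preceq$ that is non-identical (i.e. not the equality relation) is called ordered if for all $a,b,c\in R$: (1) $a\preceq b$ implies $a+c\preceq b+c$; and (2) $a\preceq b$ and $0\preceq c$ imply $ac\preceq bc$. The order need not be linear, and squares need not be non-negative. $0\prec a$ means $0\preceq a$ and $a\neq 0$. For $a\in R$ with $\mathrm{char}(R)=0$: if $a$ is algebraic over $\mathbb{Q}$ (in the field of fractions of $R$), $\min_{\mathbb{Q}}(a)$ denotes its minimal polynomial over $\mathbb{Q}$, scaled to be a non-zero element of $\mathbb{Z}[x]$; otherwise $\min_{\mathbb{Q}}(a)=0$, the zero polynomial (which has every positive real number as a root). *)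

theory Defs
  imports Complex_Main "HOL-Computational_Algebra.Computational_Algebra"
begin

definition ordered_domain :: "('a::idom \<Rightarrow> 'a \<Rightarrow> bool) \<Rightarrow> bool" where
  "ordered_domain le \<longleftrightarrow>
     reflp le \<and> antisymp le \<and> transp le \<and> le \<noteq> (=) \<and>
     (\<forall>a b c. le a b \<longrightarrow> le (a + c) (b + c)) \<and>
     (\<forall>a b c. le a b \<longrightarrow> le 0 c \<longrightarrow> le (a * c) (b * c))"

text \<open>
  The fraction field of a domain of characteristic 0 has characteristic 0. The library only has
  this instance for linearly ordered domains; it is what makes \<^const>\<open>of_rat\<close> and
  \<^const>\<open>algebraic\<close> available on it.
\<close>

instance fract :: ("{idom, ring_char_0}") field_char_0
proof
  show "inj (of_nat :: nat \<Rightarrow> 'a fract)"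
    by (rule injI) (simp add: of_nat_fract eq_fract)
qed

definition is_min_poly_rat :: "'f::field_char_0 \<Rightarrow> rat poly \<Rightarrow> bool" where
  "is_min_poly_rat x p \<longleftrightarrow>
     lead_coeff p = 1 \<and> poly (map_poly of_rat p) x = 0 \<and>
     (\<forall>q. q \<noteq> 0 \<longrightarrow> poly (map_poly of_rat q) x = 0 \<longrightarrow> degree p \<le> degree q)"

definition min_poly_rat :: "'f::field_char_0 \<Rightarrow> rat poly" where
  "min_poly_rat x = (THE p. is_min_poly_rat x p)"

text \<open>
  The scaling factor that clears denominators is not canonical (two choices differ by a nonzero
  rational factor), so an arbitrary one is taken.
\<close>

definition min_Q :: "'a::{idom, ring_char_0} \<Rightarrow> int poly" where
  "min_Q a =
     (if algebraic (to_fract a)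
      then SOME q. q \<noteq> 0 \<and> (\<exists>c. map_poly of_int q = smult c (min_poly_rat (to_fract a)))
      else 0)"

lemma min_poly_rat_ex1:
  assumes "algebraic (x :: 'f::field_char_0)"
  shows "\<exists>!p. is_min_poly_rat x p"
proof -
  define P where "P = (\<lambda>q::rat poly. q \<noteq> 0 \<and> poly (map_poly of_rat q) x = 0)"
  have hom_smult: "poly (map_poly of_rat (smult c q)) x = of_rat c * poly (map_poly of_rat q) x"
    for c and q :: "rat poly"
  proof -
    have "map_poly (of_rat :: rat \<Rightarrow> 'f) (smult c q) = smult (of_rat c) (map_poly of_rat q)"
      by (rule poly_eqI) (simp add: coeff_map_poly of_rat_mult)
    then show ?thesis by simp
  qed
  have hom_diff: "poly (map_poly of_rat (p - q)) x
      = poly (map_poly of_rat p) x - poly (map_poly of_rat q) x" for p q :: "rat poly"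
  proof -
    have "map_poly (of_rat :: rat \<Rightarrow> 'f) (p - q) = map_poly of_rat p - map_poly of_rat q"
      by (rule poly_eqI) (simp add: coeff_map_poly of_rat_diff)
    then show ?thesis by simp
  qed
  from assms obtain r where r: "r \<noteq> 0" "poly (map_poly of_int r) x = 0"
    by (rule algebraicE')
  have "map_poly of_rat (map_poly of_int r :: rat poly) = (map_poly of_int r :: 'f poly)"
    by (rule poly_eqI) (simp add: coeff_map_poly)
  with r(2) have "poly (map_poly of_rat (map_poly of_int r :: rat poly)) x = 0" by simp
  moreover have "(map_poly of_int r :: rat poly) \<noteq> 0"
    using r(1) by (auto simp: poly_eq_iff coeff_map_poly)
  ultimately have "P (map_poly of_int r)" by (simp add: P_def)
  then obtain m where m: "P m" "\<And>q. P q \<Longrightarrow> degree m \<le> degree q"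
    using ex_has_least_nat[of P _ degree] by blast
  define p where "p = smult (inverse (lead_coeff m)) m"
  have "is_min_poly_rat x p"
    using m by (auto simp: is_min_poly_rat_def p_def P_def hom_smult)
  moreover have "q = p" if q: "is_min_poly_rat x q" for q
  proof (rule ccontr)
    assume "q \<noteq> p"
    then have *: "q - p \<noteq> 0" by simp
    have root: "poly (map_poly of_rat (q - p)) x = 0"
      using q \<open>is_min_poly_rat x p\<close> by (simp add: hom_diff is_min_poly_rat_def)
    have nz: "p \<noteq> 0" "q \<noteq> 0"
      using q \<open>is_min_poly_rat x p\<close> by (auto simp: is_min_poly_rat_def)
    then have deg: "degree p = degree q"
      using q \<open>is_min_poly_rat x p\<close> by (auto simp: is_min_poly_rat_def intro!: antisym)
    have "degree p \<le> degree (q - p)"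
      using \<open>is_min_poly_rat x p\<close> * root by (auto simp: is_min_poly_rat_def)
    moreover have "degree (q - p) \<le> degree p"
      using degree_diff_le_max[of q p] deg by simp
    ultimately have "degree (q - p) = degree p" by simp
    then have "lead_coeff (q - p) = 0"
      using q \<open>is_min_poly_rat x p\<close> deg by (simp add: is_min_poly_rat_def)
    with * show False by (metis leading_coeff_0_iff)
  qed
  ultimately show ?thesis by blast
qed

lemma min_poly_rat:
  "algebraic x \<Longrightarrow> is_min_poly_rat x (min_poly_rat x)"
  unfolding min_poly_rat_def by (rule theI') (rule min_poly_rat_ex1)

lemma min_Q_algebraic:
  assumes "algebraic (to_fract (a :: 'a::{idom, ring_char_0}))"
  shows "min_Q a \<noteq> 0"
    and "\<exists>c. map_poly of_int (min_Q a) = smult c (min_poly_rat (to_fract a))"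
proof -
  let ?p = "min_poly_rat (to_fract a)"
  have nz: "?p \<noteq> 0"
    using min_poly_rat[OF assms] by (auto simp: is_min_poly_rat_def)
  define d where "d = (\<Prod>i\<le>degree ?p. snd (quotient_of (coeff ?p i)))"
  have d0: "d \<noteq> 0"
    unfolding d_def using quotient_of_denom_pos' by (auto simp: prod_zero_iff less_le)
  have int: "of_int d * coeff ?p i \<in> \<int>" for i
  proof (cases "i \<le> degree ?p")
    case True
    obtain n k where nk: "quotient_of (coeff ?p i) = (n, k)" by (cases "quotient_of (coeff ?p i)")
    have "k dvd d"
      unfolding d_def using True nk dvd_prodI[of "{..degree ?p}" i "\<lambda>i. snd (quotient_of (coeff ?p i))"]
      by simp
    then obtain e where "d = k * e" by (auto simp: dvd_def)
    moreover have "coeff ?p i = of_int n / of_int k" "k > 0"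
      using quotient_of_div[OF nk] quotient_of_denom_pos[OF nk] by auto
    ultimately have "of_int d * coeff ?p i = of_int (e * n)" by simp
    then show ?thesis by (metis Ints_of_int)
  qed (simp add: coeff_eq_0)
  define q where "q = map_poly floor (smult (of_int d) ?p)"
  have q: "map_poly of_int q = smult (of_int d) ?p"
  proof (rule poly_eqI)
    fix i
    show "coeff (map_poly of_int q) i = coeff (smult (of_int d) ?p) i"
      using int[of i] by (auto simp: q_def coeff_map_poly elim!: Ints_cases)
  qed
  with d0 nz have "q \<noteq> 0" by auto
  with q have "\<exists>q. q \<noteq> 0 \<and> (\<exists>c. map_poly of_int q = smult c ?p)" by blast
  from someI_ex[OF this] show "min_Q a \<noteq> 0"
    and "\<exists>c. map_poly of_int (min_Q a) = smult c ?p"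
    using assms by (simp_all add: min_Q_def)
qed

end

theory Submission
  imports Defs
begin

text \<open>
  If the minimal polynomial \<open>p\<close> of \<open>a\<close> has a positive root \<open>x\<close>, then the values \<open>f(a)\<close> of integer
  polynomials \<open>f\<close> with nonnegative coefficients form a positive cone: \<open>f(a) + g(a) = 0\<close> would give
  \<open>f(x) + g(x) = 0\<close>. Conversely, if \<open>p\<close> has no positive root, then by a theorem of Poincare some
  \<open>(1 + X)^n p\<close> has coefficients of constant sign; its value at \<open>a\<close> is a vanishing
  nontrivial combination of powers of \<open>a\<close>, which is impossible when \<open>a\<close> is positive.
  Poincare's theorem is reduced to a single quadratic factor by factoring \<open>p\<close> over the reals.
\<close>

section \<open>Coefficientwise ring homomorphisms and passage to the fraction field\<close>

lemma map_poly_hom_add: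
  assumes "h 0 = 0" "\<And>x y. h (x + y) = h x + h y"
  shows "map_poly h (p + q) = map_poly h p + map_poly h q"
  by (rule poly_eqI) (simp add: coeff_map_poly assms)

lemma map_poly_hom_mult:
  fixes h :: "'a::comm_semiring_0 \<Rightarrow> 'b::comm_semiring_0"
  assumes "h 0 = 0" "\<And>x y. h (x + y) = h x + h y" "\<And>x y. h (x * y) = h x * h y"
  shows "map_poly h (p * q) = map_poly h p * map_poly h q"
  by (induction p)
     (simp_all add: map_poly_pCons map_poly_hom_add map_poly_smult assms)

lemmas of_int_poly_add = map_poly_hom_add[of of_int, OF of_int_0 of_int_add]
lemmas of_int_poly_mult = map_poly_hom_mult[of of_int, OF of_int_0 of_int_add of_int_mult]
lemmas of_rat_poly_add = map_poly_hom_add[of of_rat, OF of_rat_0 of_rat_add]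
lemmas of_rat_poly_mult = map_poly_hom_mult[of of_rat, OF of_rat_0 of_rat_add of_rat_mult]
lemmas of_real_poly_add = map_poly_hom_add[of of_real, OF of_real_0 of_real_add]
lemmas of_real_poly_mult = map_poly_hom_mult[of of_real, OF of_real_0 of_real_add of_real_mult]

lemma of_rat_poly_of_int_poly:
  "map_poly of_rat (map_poly of_int p) = (map_poly of_int p :: 'a::field_char_0 poly)"
  by (rule poly_eqI) (simp add: coeff_map_poly)

lemma of_int_fract: "(of_int n :: 'a::idom fract) = to_fract (of_int n)"
proof (cases n rule: int_cases2)
  case (nonneg m)
  then show ?thesis by (simp add: of_nat_fract to_fract_def)
next
  case (nonpos m)
  then show ?thesis by (simp add: of_nat_fract to_fract_def)
qed

text \<open>Since \<open>to_fract\<close> is injective, an integer polynomial vanishes at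
  \<open>a\<close> exactly when it vanishes at the image of \<open>a\<close> in the fraction field,
  where \<open>min_poly_rat\<close> is formed.\<close>

lemma poly_of_int_to_fract:
  "poly (map_poly of_int p) (to_fract a) = to_fract (poly (map_poly of_int p) a)"
  by (induction p) (simp_all add: map_poly_pCons of_int_fract)

section \<open>Polynomials with nonnegative coefficients\<close>

definition nonneg_coeffs :: "'a::linordered_idom poly \<Rightarrow> bool" where
  "nonneg_coeffs p \<longleftrightarrow> (\<forall>i. coeff p i \<ge> 0)"

lemma nonneg_coeffs_add: "nonneg_coeffs p \<Longrightarrow> nonneg_coeffs q \<Longrightarrow> nonneg_coeffs (p + q)"
  by (simp add: nonneg_coeffs_def)

lemma nonneg_coeffs_mult: "nonneg_coeffs p \<Longrightarrow> nonneg_coeffs q \<Longrightarrow> nonneg_coeffs (p * q)"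
  by (auto simp: nonneg_coeffs_def coeff_mult intro!: sum_nonneg)

lemma nonneg_coeffs_pCons [simp]: "nonneg_coeffs (pCons c p) \<longleftrightarrow> c \<ge> 0 \<and> nonneg_coeffs p"
proof -
  have "(\<forall>i. coeff (pCons c p) i \<ge> 0) \<longleftrightarrow> coeff (pCons c p) 0 \<ge> 0 \<and> (\<forall>i. coeff (pCons c p) (Suc i) \<ge> 0)"
    by (metis not0_implies_Suc)
  then show ?thesis by (simp add: nonneg_coeffs_def)
qed

lemma nonneg_coeffs_0 [simp]: "nonneg_coeffs 0"
  by (simp add: nonneg_coeffs_def)

lemma nonneg_coeffs_add_eq_0:
  assumes "nonneg_coeffs p" "nonneg_coeffs q" "p + q = 0"
  shows "p = 0"
proof (rule poly_eqI)
  fix i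
  have "coeff p i + coeff q i = 0"
    using assms(3) by (metis coeff_0 coeff_add)
  then show "coeff p i = coeff 0 i"
    using assms(1,2) by (simp add: nonneg_coeffs_def add_nonneg_eq_0_iff)
qed

text \<open>At a positive point every term of the evaluated sum is nonnegative, so a vanishing sum
  forces each term, hence each coefficient, to vanish.\<close>

lemma nonneg_coeffs_no_pos_root:
  assumes "nonneg_coeffs p" "poly p x = 0" "x > 0"
  shows "p = 0"
proof (rule poly_eqI)
  fix i
  have nonneg: "coeff p j * x ^ j \<ge> 0" for j
    using assms by (simp add: nonneg_coeffs_def)
  show "coeff p i = coeff 0 i"
  proof (cases "i \<le> degree p")
    case True
    have "(\<Sum>j\<le>degree p. coeff p j * x ^ j) = 0"
      using assms(2) by (simp add: poly_altdef)
    then have "coeff p i * x ^ i = 0"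
      using True nonneg by (simp add: sum_nonneg_eq_0_iff)
    with assms(3) show ?thesis by simp
  qed (simp add: coeff_eq_0)
qed

section \<open>Poincare's theorem for a quadratic factor\<close>

text \<open>The coefficient combines the binomials of \<open>n\<close> over \<open>k\<close>,
  \<open>k - 1\<close> and \<open>k - 2\<close>; absorption turns each into a multiple of the
  binomial of \<open>n + 2\<close> over \<open>k\<close>. Its sign is that of the form x^2 + u x y +
  v y^2 at (k, m) minus the linear correction k + v m.\<close>

lemma binomial_weighted_quadratic:
  fixes u v :: real
  assumes "k + m = Suc (Suc n)"
  shows "real (Suc n) * real (Suc (Suc n)) * coeff ([:1, 1:] ^ n * [:v, u, 1:]) k
       = real (Suc (Suc n) choose k)
          * (real k * (real k - 1) + u * real k * real m + v * real m * (real m - 1))"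
proof -
  let ?C = "\<lambda>n k. real (n choose k)"
  have down: "real k * ?C (Suc n) k = real (Suc n) * ?C n (k - 1)" if "k > 0" for n k
    using Suc_times_binomial[of "k - 1" n] that by (metis Suc_pred' of_nat_mult)
  \<comment> \<open>The subtraction is real: for \<open>k > Suc n\<close> its value is negative, but
    then both binomials vanish.\<close>
  have comp: "(real (Suc n) - real k) * ?C (Suc n) k = real (Suc n) * ?C n k" for n k
  proof (cases "k \<le> Suc n")
    case True
    with binomial_absorb_comp[of "Suc n" k] show ?thesis
      by (metis diff_Suc_1 of_nat_diff of_nat_mult)
  qed (simp add: binomial_eq_0)
  have m: "real m = real (Suc (Suc n)) - real k"
    using assms by simp
  have mC: "real m * ?C (Suc (Suc n)) k = real (Suc (Suc n)) * ?C (Suc n) k"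
    unfolding m by (rule comp)
  have m1C: "(real m - 1) * ?C (Suc n) k = real (Suc n) * ?C n k"
    using comp[of n k] unfolding m by (simp add: algebra_simps)
  have vterm: "v * real m * (real m - 1) * ?C (Suc (Suc n)) k
      = real (Suc n) * real (Suc (Suc n)) * (v * ?C n k)"
    using mC m1C by algebra
  have pow: "coeff ([:1, 1:] ^ n) i = ?C n i" for i
    by (cases "i \<le> n") (simp_all add: coeff_linear_poly_power coeff_eq_0 degree_linear_power)
  \<comment> \<open>The guards matter because subtraction truncates: for k = 0, say,
    \<open>n choose (k - 1)\<close> is 1 rather than 0.\<close>
  have coeff: "coeff ([:1, 1:] ^ n * [:v, u, 1:]) k
      = v * ?C n k + (if k > 0 then u * ?C n (k - 1) else 0) + (if k > 1 then ?C n (k - 2) else 0)"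
    by (cases k; cases "k - 1") (simp_all add: pow algebra_simps)
  have uterm: "u * real k * real m * ?C (Suc (Suc n)) k
      = real (Suc n) * real (Suc (Suc n)) * (if k > 0 then u * ?C n (k - 1) else 0)"
  proof (cases "k > 0")
    case True
    have "real m * ?C (Suc n) (k - 1) = real (Suc n) * ?C n (k - 1)"
      using comp[of n "k - 1"] True unfolding m by (simp add: add_diff_eq)
    with down[OF True, of "Suc n"] True show ?thesis by simp algebra
  qed simp
  have kterm: "real k * (real k - 1) * ?C (Suc (Suc n)) k
      = real (Suc n) * real (Suc (Suc n)) * (if k > 1 then ?C n (k - 2) else 0)"
  proof (cases "k > 1")
    case True
    have "(real k - 1) * ?C (Suc n) (k - 1) = real (Suc n) * ?C n (k - 2)"
      using down[of "k - 1" n] True by (simp add: numeral_2_eq_2)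
    with down[of k "Suc n"] True show ?thesis by simp algebra
  next
    case False
    then have "k = 0 \<or> k = 1" by auto
    then show ?thesis by auto
  qed
  show ?thesis
    unfolding coeff using uterm vterm kterm by (simp only: algebra_simps)
qed

text \<open>For u \<ge> 0 the factor itself has nonnegative coefficients. Otherwise, x^2 + u x y + v
  y^2 is positive definite, hence at least e (x + y)^2 for some e > 0; on x + y = n + 2 this bound
  beats the linear correction once n is large.\<close>

lemma power_mult_quadratic_nonneg_coeffs:
  fixes u v :: real
  assumes "u\<^sup>2 < 4 * v"
  shows "\<exists>n. nonneg_coeffs ([:1, 1:] ^ n * [:v, u, 1:])"
proof (cases "u \<ge> 0")
  case True
  have "v > 0" using assms zero_le_power2[of u] by linarith
  with True have "nonneg_coeffs ([:1, 1:] ^ 0 * [:v, u, 1:])" by simp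
  then show ?thesis by blast
next
  case False
  have v: "v > 0" using assms zero_le_power2[of u] by linarith
  \<comment> \<open>the largest \<open>e\<close> for which the quadratic form below minus \<open>e * (x + y)\<^sup>2\<close> is positive semidefinite\<close>
  define e where "e = (4 * v - u\<^sup>2) / (4 * (1 + v - u))"
  have e_eq: "4 * (1 + v - u) * e = 4 * v - u\<^sup>2"
    using False v by (simp add: e_def)
  have e0: "e > 0" using False v assms by (simp add: e_def)
  \<comment> \<open>Right side minus left side is (2 - u)^2, positive as u < 0. The resulting
    \<open>e < 1\<close> makes the x^2 coefficient 1 - e of the difference in \<open>form\<close>
    positive.\<close>
  have "4 * v - u\<^sup>2 < 4 * (1 + v - u)"
    using False by (simp add: algebra_simps less_le_trans[of "u * 4" 0] add_nonneg_nonneg)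
  then have e1: "e < 1" using False v by (simp add: e_def)
  have form: "e * (x + y)\<^sup>2 \<le> x\<^sup>2 + u * x * y + v * y\<^sup>2" for x y
  proof -
    \<comment> \<open>Completing the square: \<open>e_eq\<close> says exactly that the discriminant
      (u - 2e)^2 - 4(1 - e)(v - e) vanishes.\<close>
    have "4 * (1 - e) * (x\<^sup>2 + u * x * y + v * y\<^sup>2 - e * (x + y)\<^sup>2)
        = (2 * (1 - e) * x + (u - 2 * e) * y)\<^sup>2"
      using e_eq by algebra
    then have "0 \<le> (1 - e) * (x\<^sup>2 + u * x * y + v * y\<^sup>2 - e * (x + y)\<^sup>2)"
      using zero_le_power2[of "2 * (1 - e) * x + (u - 2 * e) * y"] by linarith
    with e1 show ?thesis by (simp add: zero_le_mult_iff)
  qed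
  \<comment> \<open>With this choice e (n + 2) \<ge> 1 + v, so e (k + m)^2 dominates k + v m
    whenever k + m = n + 2.\<close>
  obtain n where n: "(1 + v) / e < real n" using reals_Archimedean2 by blast
  have "coeff ([:1, 1:] ^ n * [:v, u, 1:]) k \<ge> 0" for k
  proof (cases "k \<le> Suc (Suc n)")
    case True
    define m where "m = Suc (Suc n) - k"
    have km: "k + m = Suc (Suc n)" using True by (simp add: m_def)
    have s: "real k + real m = real n + 2" using km by linarith
    have "1 + v \<le> e * (real k + real m)"
      using n e0 unfolding s by (simp add: field_simps add_pos_pos)
    then have "(1 + v) * (real k + real m) \<le> e * (real k + real m) * (real k + real m)"
      by (rule mult_right_mono) simp
    moreover have "real k + v * real m \<le> (1 + v) * (real k + real m)"
      using v by (simp add: algebra_simps)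
    ultimately have "real k + v * real m \<le> e * (real k + real m)\<^sup>2"
      by (simp add: power2_eq_square)
    also have "\<dots> \<le> (real k)\<^sup>2 + u * real k * real m + v * (real m)\<^sup>2"
      by (rule form)
    finally have "0 \<le> real k * (real k - 1) + u * real k * real m + v * real m * (real m - 1)"
      by (simp add: algebra_simps power2_eq_square)
    then have "0 \<le> real (Suc n) * real (Suc (Suc n)) * coeff ([:1, 1:] ^ n * [:v, u, 1:]) k"
      unfolding binomial_weighted_quadratic[OF km] by simp
    moreover have "real (Suc n) * real (Suc (Suc n)) > 0" by simp
    ultimately show ?thesis by (metis zero_le_mult_iff not_less)
  next
    case False
    have "degree ([:1, 1:] ^ n * [:v, u, 1:]) \<le> n + 2"
      by (rule order_trans[OF degree_mult_le]) (simp add: degree_linear_power)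
    with False have "degree ([:1, 1:] ^ n * [:v, u, 1:]) < k" by linarith
    then show ?thesis by (simp only: coeff_eq_0)
  qed
  then show ?thesis unfolding nonneg_coeffs_def by blast
qed

section \<open>Real factorization and the general case of Poincare's theorem\<close>

text \<open>Take a complex root z. If it is not real, the quadratic factor is the one with roots z
  and its conjugate, whose discriminant is -4 (Im z)^2.\<close>

lemma real_poly_factor:
  fixes p :: "real poly"
  assumes "degree p > 0"
  obtains (linear) x where "[:- x, 1:] dvd p"
        | (quadratic) u v where "u\<^sup>2 < 4 * v" "[:v, u, 1:] dvd p"
proof -
  let ?c = "map_poly complex_of_real"
  have "\<not> constant (poly (?c p))"
    using assms by (simp add: constant_degree degree_map_poly)
  then obtain z where z: "poly (?c p) z = 0"
    using fundamental_theorem_of_algebra by blast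
  show thesis
  proof (cases "Im z = 0")
    case True
    then have "z = complex_of_real (Re z)" by (simp add: complex_eq_iff)
    moreover have "poly (?c p) (complex_of_real x) = complex_of_real (poly p x)" for x
      by (induction p) (simp_all add: map_poly_pCons)
    ultimately have "poly p (Re z) = 0" using z by (metis of_real_eq_0_iff)
    then show thesis by (intro linear) (simp add: poly_eq_0_iff_dvd)
  next
    case False
    define u v where "u = - 2 * Re z" and "v = (Re z)\<^sup>2 + (Im z)\<^sup>2"
    define q where "q = [:v, u, 1:]"
    define r where "r = p mod q"
    have qz: "poly (?c q) z = 0"
      by (simp add: q_def u_def v_def map_poly_pCons complex_eq_iff power2_eq_square algebra_simps)
    have "?c p = ?c q * ?c (p div q) + ?c r"
      unfolding r_def of_real_poly_mult[symmetric] of_real_poly_add[symmetric] by simp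
    then have rz: "poly (?c r) z = 0"
      using z qz by simp
    have "degree r < 2"
      using degree_mod_less[of q p] by (auto simp: q_def r_def)
    then have "r = [:coeff r 0, coeff r 1:]"
      by (intro poly_eqI) (auto simp: coeff_pCons coeff_eq_0 split: nat.split)
    then obtain c d where r: "r = [:c, d:]" by blast
    \<comment> \<open>The remainder c + d X vanishes at z; the imaginary part d * Im z being 0 gives
      d = 0, and then c = 0.\<close>
    have "d = 0" "c = 0"
      using rz False by (auto simp: r map_poly_pCons complex_eq_iff)
    then have "q dvd p" by (simp add: r dvd_eq_mod_eq_0 flip: r_def)
    moreover have "u\<^sup>2 < 4 * v"
      using False by (simp add: u_def v_def power_mult_distrib)
    ultimately show thesis by (intro quadratic) (auto simp: q_def)
  qed
qed

text \<open>Induction on the degree, splitting off one monic linear or quadratic factor. Products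
  preserve nonnegative coefficients, and the exponents of 1 + X for the two factors add up.\<close>

lemma power_mult_no_pos_root_nonneg_coeffs:
  fixes p :: "real poly"
  assumes "\<And>x. x > 0 \<Longrightarrow> poly p x \<noteq> 0" "lead_coeff p > 0"
  shows "\<exists>n. nonneg_coeffs ([:1, 1:] ^ n * p)"
  using assms
proof (induction "degree p" arbitrary: p rule: less_induct)
  case less
  \<comment> \<open>As \<open>q\<close> is monic, the cofactor \<open>s\<close> keeps the positive
    leading coefficient; as a divisor of \<open>p\<close> it has no positive root, so the induction
    hypothesis applies to it.\<close>
  have step: ?case if "p = q * s" "degree q > 0" "lead_coeff q = 1"
    and q: "\<exists>n. nonneg_coeffs ([:1, 1:] ^ n * q)" for q s
  proof -
    have "s \<noteq> 0" "q \<noteq> 0" using less.prems(2) that by auto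
    then have "degree s < degree p" using that by (simp add: degree_mult_eq)
    moreover have "lead_coeff s > 0" using less.prems(2) that by (simp add: lead_coeff_mult)
    moreover have "poly s x \<noteq> 0" if "x > 0" for x
      using less.prems(1)[OF that] \<open>p = q * s\<close> by auto
    ultimately obtain m where "nonneg_coeffs ([:1, 1:] ^ m * s)"
      using less.hyps by blast
    moreover obtain n where "nonneg_coeffs ([:1, 1:] ^ n * q)" using q by blast
    ultimately have "nonneg_coeffs (([:1, 1:] ^ m * s) * ([:1, 1:] ^ n * q))"
      by (rule nonneg_coeffs_mult)
    then have "nonneg_coeffs ([:1, 1:] ^ (n + m) * p)"
      by (simp only: \<open>p = q * s\<close> power_add mult_ac)
    then show ?thesis by blast
  qed
  show ?case
  proof (cases "degree p = 0")
    case True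
    then obtain c where "p = [:c:]" by (rule degree_eq_zeroE)
    with less.prems(2) have "nonneg_coeffs ([:1, 1:] ^ 0 * p)" by simp
    then show ?thesis by blast
  next
    case False
    then have "degree p > 0" by simp
    then show ?thesis
    proof (cases rule: real_poly_factor)
      case (linear x)
      then have "\<not> x > 0"
        using less.prems(1)[of x] by (auto simp: poly_eq_0_iff_dvd)
      \<comment> \<open>Here x \<le> 0, so X - x already has nonnegative coefficients.\<close>
      then have x: "\<exists>n. nonneg_coeffs ([:1, 1:] ^ n * [:- x, 1:])"
        by (intro exI[of _ 0]) simp
      obtain s where "p = [:- x, 1:] * s" using linear by (rule dvdE)
      from step[OF this _ _ x] show ?thesis by simp
    next
      case (quadratic u v)
      obtain s where "p = [:v, u, 1:] * s" using quadratic(2) by (rule dvdE)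
      from step[OF this _ _ power_mult_quadratic_nonneg_coeffs[OF quadratic(1)]]
      show ?thesis by simp
    qed
  qed
qed

section \<open>Poincare's theorem for integer polynomials\<close>

lemma nonneg_coeffs_of_int:
  "nonneg_coeffs (map_poly of_int p :: real poly) \<longleftrightarrow> nonneg_coeffs p"
  by (simp add: nonneg_coeffs_def coeff_map_poly)

text \<open>The multiplier is (1 + X)^n times the sign of the leading coefficient of
  \<open>p\<close>; it is integral, so the real result descends.\<close>

lemma int_poly_nonneg_multiple:
  fixes p :: "int poly"
  assumes "p \<noteq> 0" "\<And>x::real. x > 0 \<Longrightarrow> poly (map_poly of_int p) x \<noteq> 0"
  obtains g where "g \<noteq> 0" "nonneg_coeffs (g * p)"
proof -
  let ?r = "map_poly (of_int :: int \<Rightarrow> real)"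
  define c where "c = sgn (lead_coeff p)"
  have c: "c \<noteq> 0" using assms(1) by (simp add: c_def sgn_eq_0_iff)
  have "lead_coeff (?r (smult c p)) = of_int (c * lead_coeff p)"
    using c by (simp add: degree_map_poly coeff_map_poly)
  moreover have "c * lead_coeff p > 0"
    unfolding c_def by (metis abs_sgn assms(1) leading_coeff_0_iff mult.commute zero_less_abs_iff)
  ultimately have lc: "lead_coeff (?r (smult c p)) > 0"
    by (simp only: of_int_0_less_iff)
  have "poly (?r (smult c p)) x \<noteq> 0" if "x > 0" for x
    using assms(2)[OF that] c by (simp add: map_poly_smult)
  from power_mult_no_pos_root_nonneg_coeffs[OF this lc]
  obtain n where n: "nonneg_coeffs ([:1, 1:] ^ n * ?r (smult c p))" by blast
  have "?r ([:1, 1:] ^ k) = [:1, 1:] ^ k" for k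
    by (induction k) (simp_all only: power_0 power_Suc of_int_poly_mult, simp_all add: map_poly_pCons)
  then have "?r ([:1, 1:] ^ n * smult c p) = [:1, 1:] ^ n * ?r (smult c p)"
    by (simp only: of_int_poly_mult)
  with n have "nonneg_coeffs ([:1, 1:] ^ n * smult c p)"
    by (metis nonneg_coeffs_of_int)
  then have "nonneg_coeffs (smult c ([:1, 1:] ^ n) * p)" by simp
  moreover have "smult c ([:1, 1:] ^ n) \<noteq> 0" using c by simp
  ultimately show thesis using that by blast
qed

section \<open>Integer relations satisfied by \<open>a\<close> and the roots of
  \<open>min_Q a\<close>\<close>

lemma poly_min_Q:
  fixes a :: "'a::{idom, ring_char_0}"
  shows "poly (map_poly of_int (min_Q a)) a = 0"
proof (cases "algebraic (to_fract a)")
  case True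
  then obtain c where c: "map_poly of_int (min_Q a) = smult c (min_poly_rat (to_fract a))"
    using min_Q_algebraic(2) by blast
  have "map_poly of_int (min_Q a)
      = (map_poly of_rat (smult c (min_poly_rat (to_fract a))) :: 'a fract poly)"
    by (simp flip: c add: of_rat_poly_of_int_poly)
  then have "poly (map_poly of_int (min_Q a)) (to_fract a) = 0"
    using min_poly_rat[OF True]
    by (simp add: map_poly_smult of_rat_mult is_min_poly_rat_def)
  then show ?thesis by (simp add: poly_of_int_to_fract)
qed (simp add: min_Q_def)

text \<open>The remainder of \<open>f\<close> modulo \<open>m\<close> also vanishes at
  \<open>x\<close>; minimality of the degree of \<open>m\<close> forces it to be zero.\<close>

lemma is_min_poly_rat_dvd:
  assumes "is_min_poly_rat x m" "poly (map_poly of_rat f) x = 0"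
  shows "m dvd f"
proof -
  define r where "r = f mod m"
  have m: "m \<noteq> 0" "poly (map_poly of_rat m) x = 0"
    using assms(1) by (auto simp: is_min_poly_rat_def)
  have "map_poly of_rat f
      = map_poly of_rat m * map_poly of_rat (f div m) + (map_poly of_rat r :: 'a poly)"
    unfolding r_def of_rat_poly_mult[symmetric] of_rat_poly_add[symmetric] by simp
  then have "poly (map_poly of_rat r) x = 0"
    using assms(2) m by simp
  moreover have "r = 0 \<or> degree r < degree m"
    unfolding r_def using m(1) by (rule degree_mod_less)
  ultimately have "r = 0"
    using assms(1) by (auto simp: is_min_poly_rat_def not_le[symmetric])
  then show ?thesis by (simp add: r_def dvd_eq_mod_eq_0)
qed

text \<open>This makes f(a) \<mapsto> f(x) a well-defined ring homomorphism from Z[a] to the reals: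
  over the rationals, every relation of an algebraic \<open>a\<close> is a multiple of the minimal
  polynomial, so \<open>x\<close> inherits it.\<close>

lemma min_Q_root_transfer:
  fixes a :: "'a::{idom, ring_char_0}" and x :: real
  assumes f: "poly (map_poly of_int f) a = 0"
    and x: "poly (map_poly of_int (min_Q a)) x = 0"
  shows "poly (map_poly of_int f) x = 0"
proof (cases "algebraic (to_fract a)")
  case True
  let ?m = "min_poly_rat (to_fract a)"
  obtain c where c: "map_poly of_int (min_Q a) = smult c ?m"
    using min_Q_algebraic(2)[OF True] by blast
  have "(map_poly of_int (min_Q a) :: rat poly) \<noteq> 0"
    using min_Q_algebraic(1)[OF True] by (simp add: map_poly_eq_0_iff)
  then have "c \<noteq> 0" using c by auto
  have "map_poly of_int (min_Q a) = (map_poly of_rat (smult c ?m) :: real poly)"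
    by (simp flip: c add: of_rat_poly_of_int_poly)
  then have mx: "poly (map_poly of_rat ?m) x = 0"
    using x \<open>c \<noteq> 0\<close> by (simp add: map_poly_smult of_rat_mult)
  have "poly (map_poly of_rat (map_poly of_int f)) (to_fract a) = 0"
    using f by (simp add: of_rat_poly_of_int_poly poly_of_int_to_fract)
  then have "?m dvd map_poly of_int f"
    using is_min_poly_rat_dvd[OF min_poly_rat[OF True]] by blast
  then obtain s where "map_poly of_int f = ?m * s" by (rule dvdE)
  then have "map_poly of_int f = map_poly of_rat ?m * (map_poly of_rat s :: real poly)"
    by (metis of_rat_poly_mult of_rat_poly_of_int_poly)
  with mx show ?thesis by simp
next
  case False
  \<comment> \<open>A transcendental \<open>a\<close> satisfies only the trivial integer
    relation.\<close>
  have "f = 0"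
  proof (rule ccontr)
    assume "f \<noteq> 0"
    have "algebraic (to_fract a)"
    proof (rule algebraicI)
      show "coeff (map_poly of_int f) i \<in> \<int>" for i
        by (simp add: coeff_map_poly)
      show "map_poly of_int f \<noteq> (0 :: 'a fract poly)"
        using \<open>f \<noteq> 0\<close> by (simp add: map_poly_eq_0_iff)
      show "poly (map_poly of_int f) (to_fract a) = 0"
        using f by (simp add: poly_of_int_to_fract)
    qed
    with False show False by blast
  qed
  then show ?thesis by simp
qed

section \<open>Ordered domains and positive cones\<close>

lemma ordered_domainD:
  assumes "ordered_domain le"
  shows "le x y \<Longrightarrow> le y x \<Longrightarrow> x = y"
    and "le 0 x \<Longrightarrow> le 0 y \<Longrightarrow> le 0 (x + y)"
    and "le 0 x \<Longrightarrow> le 0 y \<Longrightarrow> le 0 (x * y)"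
    and "le 0 0"
proof -
  have tr: "le x z" if "le x y" "le y z" for x y z
    using assms that by (auto simp: ordered_domain_def dest: transpD)
  have add: "le (x + z) (y + z)" if "le x y" for x y z
    using assms that by (auto simp: ordered_domain_def)
  have mult: "le (x * z) (y * z)" if "le x y" "le 0 z" for x y z
    using assms that unfolding ordered_domain_def by blast
  show "le x y \<Longrightarrow> le y x \<Longrightarrow> x = y"
    using assms by (auto simp: ordered_domain_def dest: antisympD)
  show "le 0 x \<Longrightarrow> le 0 y \<Longrightarrow> le 0 (x + y)"
    using add[of 0 x y] tr[of 0 y "x + y"] by simp
  show "le 0 x \<Longrightarrow> le 0 y \<Longrightarrow> le 0 (x * y)"
    using mult[of 0 x y] by simp
  show "le 0 0"
    using assms by (auto simp: ordered_domain_def dest: reflpD)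
qed

text \<open>Adding \<open>x\<close> to \<open>le 0 y\<close> gives \<open>le x 0\<close>, so
  antisymmetry applies.\<close>

lemma ordered_domain_add_eq_0:
  assumes le: "ordered_domain le" and "le 0 x" "le 0 y" "x + y = 0"
  shows "x = 0"
proof -
  have "le (0 + x) (y + x)"
    using le \<open>le 0 y\<close> unfolding ordered_domain_def by blast
  then have "le x 0" using assms(4) by (simp add: add.commute)
  with assms(2) show ?thesis using ordered_domainD(1)[OF le] by metis
qed

lemma ordered_domain_nonneg_of_nat_mult:
  assumes "ordered_domain le" "le 0 x"
  shows "le 0 (of_nat n * x)"
  by (induction n)
     (use assms in \<open>simp_all add: ordered_domainD(2,4) distrib_right\<close>)

text \<open>The extra factor \<open>a\<close> is needed because \<open>1\<close> need not be positive.\<close>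

lemma ordered_domain_nonneg_coeffs:
  fixes a :: "'a::{idom, ring_char_0}"
  assumes le: "ordered_domain le" and a: "le 0 a" "a \<noteq> 0" and f: "nonneg_coeffs f"
  shows "le 0 (a * poly (map_poly of_int f) a)"
    and "a * poly (map_poly of_int f) a = 0 \<Longrightarrow> f = 0"
proof -
  have "le 0 (a * poly (map_poly of_int f) a) \<and> (a * poly (map_poly of_int f) a = 0 \<longrightarrow> f = 0)"
    using f
  proof (induction f)
    case 0
    then show ?case by (simp add: ordered_domainD(4)[OF le])
  next
    case (pCons c f)
    \<comment> \<open>Horner's scheme: \<open>?y\<close> is the product of \<open>a\<close> and the
      value that the induction hypothesis shows nonnegative.\<close>
    let ?y = "a * (a * poly (map_poly of_int f) a)"
    have IH: "le 0 (a * poly (map_poly of_int f) a)" "a * poly (map_poly of_int f) a = 0 \<longrightarrow> f = 0"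
      using pCons by simp_all
    have eq: "a * poly (map_poly of_int (pCons c f)) a = of_int c * a + ?y"
      by (simp add: map_poly_pCons algebra_simps)
    have "c \<ge> 0" using pCons.prems by simp
    then have c: "le 0 (of_int c * a)"
      using ordered_domain_nonneg_of_nat_mult[OF le a(1), of "nat c"] by simp
    have y: "le 0 ?y" using ordered_domainD(3)[OF le] a(1) IH(1) by blast
    have "pCons c f = 0" if "of_int c * a + ?y = 0"
    proof -
      \<comment> \<open>Nonnegative summands cannot cancel, so both vanish; characteristic 0 and the
        absence of zero divisors give c = 0 and, through \<open>IH\<close>, f = 0.\<close>
      have "of_int c * a = 0" using ordered_domain_add_eq_0[OF le c y that] .
      with that a(2) IH(2) show ?thesis by simp
    qed
    with ordered_domainD(2)[OF le c y] show ?case unfolding eq by blast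
  qed
  then show "le 0 (a * poly (map_poly of_int f) a)"
    and "a * poly (map_poly of_int f) a = 0 \<Longrightarrow> f = 0" by blast+
qed

text \<open>Transitivity comes from closure under sums, antisymmetry from P meeting -P only in 0,
  and compatibility with products from bc - ac = (b - a)c. The nonzero \<open>a\<close> in
  \<open>P\<close> is comparable to 0, so the order is not equality.\<close>

lemma ordered_domain_of_cone:
  fixes P :: "'a::idom set"
  assumes "0 \<in> P" "\<And>x y. x \<in> P \<Longrightarrow> y \<in> P \<Longrightarrow> x + y \<in> P"
    "\<And>x y. x \<in> P \<Longrightarrow> y \<in> P \<Longrightarrow> x * y \<in> P"
    "\<And>x. x \<in> P \<Longrightarrow> - x \<in> P \<Longrightarrow> x = 0"
    and a: "a \<in> P" "a \<noteq> 0"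
  shows "ordered_domain (\<lambda>x y. y - x \<in> P)"
  unfolding ordered_domain_def
proof (intro conjI allI impI)
  show "reflp (\<lambda>x y. y - x \<in> P)" using assms(1) by (simp add: reflp_def)
  show "antisymp (\<lambda>x y. y - x \<in> P)"
  proof (rule antisympI)
    show "x = y" if "y - x \<in> P" "x - y \<in> P" for x y
      using assms(4)[of "y - x"] that by simp
  qed
  show "transp (\<lambda>x y. y - x \<in> P)"
  proof (rule transpI)
    show "z - x \<in> P" if "y - x \<in> P" "z - y \<in> P" for x y z
      using assms(2)[OF that] by simp
  qed
  show "(\<lambda>x y. y - x \<in> P) \<noteq> (=)"
  proof
    assume "(\<lambda>x y. y - x \<in> P) = (=)"
    from fun_cong[OF fun_cong[OF this, of 0], of a] a show False by simp
  qed
  show "b + c - (a + c) \<in> P" if "b - a \<in> P" for a b c using that by simp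
  show "b * c - a * c \<in> P" if "b - a \<in> P" "c - 0 \<in> P" for a b c
    using that assms(3)[of "b - a" c] by (simp add: left_diff_distrib)
qed

theorem theorem1p1:
  fixes a :: "'a::{idom, ring_char_0}"
  shows "(\<exists>le :: 'a \<Rightarrow> 'a \<Rightarrow> bool. ordered_domain le \<and> le 0 a \<and> a \<noteq> 0) \<longleftrightarrow>
         (\<exists>x::real. x > 0 \<and> poly (map_poly of_int (min_Q a)) x = 0)"
proof
  assume "\<exists>le :: 'a \<Rightarrow> 'a \<Rightarrow> bool. ordered_domain le \<and> le 0 a \<and> a \<noteq> 0"
  then obtain le :: "'a \<Rightarrow> 'a \<Rightarrow> bool" where le: "ordered_domain le" "le 0 a" "a \<noteq> 0" by blast
  show "\<exists>x::real. x > 0 \<and> poly (map_poly of_int (min_Q a)) x = 0"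
  proof (rule ccontr)
    assume no_root: "\<not> ?thesis"
    \<comment> \<open>The zero polynomial has the root 1, so a transcendental \<open>a\<close> is
      excluded here.\<close>
    then have nz: "min_Q a \<noteq> 0" by (metis map_poly_0 poly_0 zero_less_one)
    with no_root obtain g where g: "g \<noteq> 0" "nonneg_coeffs (g * min_Q a)"
      using int_poly_nonneg_multiple by blast
    have "a * poly (map_poly of_int (g * min_Q a)) a = 0"
      by (simp add: of_int_poly_mult poly_min_Q)
    \<comment> \<open>A polynomial with nonnegative coefficients vanishing at the positive element
      \<open>a\<close> must be zero.\<close>
    then have "g * min_Q a = 0" by (rule ordered_domain_nonneg_coeffs(2)[OF le g(2)])
    with g(1) nz show False by simp
  qed
next
  assume "\<exists>x::real. x > 0 \<and> poly (map_poly of_int (min_Q a)) x = 0"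
  then obtain x :: real where x: "x > 0" "poly (map_poly of_int (min_Q a)) x = 0" by blast
  define ev :: "int poly \<Rightarrow> 'a" where "ev f = poly (map_poly of_int f) a" for f
  have ev_add: "ev (f + g) = ev f + ev g" and ev_mult: "ev (f * g) = ev f * ev g" for f g
    by (simp_all add: ev_def of_int_poly_add of_int_poly_mult)
  \<comment> \<open>A relation with nonnegative coefficients at \<open>a\<close> would also hold at
    the positive real \<open>x\<close>, so it is trivial.\<close>
  have ev_0: "f = 0" if "nonneg_coeffs f" "ev f = 0" for f
  proof -
    have "poly (map_poly of_int f) x = 0"
      using min_Q_root_transfer[OF _ x(2)] that(2) by (simp add: ev_def)
    moreover have "nonneg_coeffs (map_poly of_int f :: real poly)"
      using that(1) by (simp add: nonneg_coeffs_of_int)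
    ultimately have "map_poly of_int f = (0 :: real poly)"
      using nonneg_coeffs_no_pos_root x(1) by blast
    then show ?thesis by (simp add: map_poly_eq_0_iff)
  qed
  \<comment> \<open>\<open>P\<close> consists of the combinations of powers of \<open>a\<close> with
    natural number coefficients.\<close>
  define P where "P = ev ` Collect nonneg_coeffs"
  have a: "a = ev [:0, 1:]" by (simp add: ev_def map_poly_pCons)
  have a0: "a \<noteq> 0" using ev_0[of "[:0, 1:]"] a by auto
  have aP: "a \<in> P" unfolding P_def by (rule image_eqI[of _ _ "[:0, 1:]"]) (simp_all flip: a)
  have "ordered_domain (\<lambda>x y. y - x \<in> P)"
  proof (rule ordered_domain_of_cone[OF _ _ _ _ aP a0])
    show "0 \<in> P" unfolding P_def by (rule image_eqI[of _ _ 0]) (simp_all add: ev_def)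
    show "x + y \<in> P" if "x \<in> P" "y \<in> P" for x y
      using that unfolding P_def by (auto simp flip: ev_add intro: nonneg_coeffs_add)
    show "x * y \<in> P" if "x \<in> P" "y \<in> P" for x y
      using that unfolding P_def by (auto simp flip: ev_mult intro: nonneg_coeffs_mult)
    show "x = 0" if x: "x \<in> P" "- x \<in> P" for x
    proof -
      obtain f where f: "x = ev f" "nonneg_coeffs f" using x(1) by (auto simp: P_def)
      obtain g where g: "- x = ev g" "nonneg_coeffs g" using x(2) by (auto simp: P_def)
      \<comment> \<open>The sum of the representations of x and -x is a relation with nonnegative
        coefficients, hence the zero polynomial, and no cancellation between \<open>f\<close> and
        \<open>g\<close> is possible.\<close>
      have "ev (f + g) = 0" using f(1) g(1) by (simp add: ev_add flip: g(1))
      then have "f + g = 0" by (rule ev_0[OF nonneg_coeffs_add[OF f(2) g(2)]])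
      then have "f = 0" by (rule nonneg_coeffs_add_eq_0[OF f(2) g(2)])
      then show ?thesis by (simp add: f(1) ev_def)
    qed
  qed
  with aP a0 show "\<exists>le :: 'a \<Rightarrow> 'a \<Rightarrow> bool. ordered_domain le \<and> le 0 a \<and> a \<noteq> 0"
    by (intro exI[of _ "\<lambda>x y. y - x \<in> P"]) simp
qed

end
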